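(* Let $p(x)$ be a real univariate polynomial of degree $n$ which is right-Noetherian. Then $p$ is strongly log-concave after the translation $x\mapsto x-x_0$. Here, $x_0$ is the largest real root of $p(x)$.
   Context: A real univariate polynomial $p$ of degree $n$ is right-Noetherian if for every $k\in\{0,\dots,n-2\}$ there exists a real root of $p^{(k)}$ which is greater than or equal to the largest real root of $p^{(k+1)}$, where $p^{(k)}$ is the $k$-th derivative of $p$. A multivariate polynomial $q(x_1,\dots,x_N)$ is strongly log-concave if its partial derivatives of any order are each either identically zero or log-concave on $\mathbb{R}^N_{>0}$; here this is used with $N=1$. The translation moves the largest real root $x_0$ to the origin, i.e. the translated polynomial is $y\mapsto p(y+x_0)$.
   Formalization: The claim for p is stated when its leading coefficient is positive; when it is negative the claim is stated for −p instead, since as written it fails, e.g. for p = −x, which is negative on the positive reals. *)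

theory Defs
  imports
    "HOL-Analysis.Analysis"
    "HOL-Computational_Algebra.Polynomial"
begin

definition is_largest_root :: "real poly \<Rightarrow> real \<Rightarrow> bool" where
  "is_largest_root p x \<longleftrightarrow> poly p x = 0 \<and> (\<forall>y. poly p y = 0 \<longrightarrow> y \<le> x)"

text \<open>
  The bound \<open>k + 2 \<le> degree p\<close> encodes \<open>k \<in> {0, \<dots>, n - 2}\<close> without truncated
  subtraction, so the condition is void for degree at most 1. Requiring the largest root
  of the next derivative to exist adds nothing: the derivative of order \<open>n - 1\<close> is linear,
  and the condition at \<open>k\<close> provides a root of the derivative of order \<open>k\<close>.
\<close>

definition right_noetherian :: "real poly \<Rightarrow> bool" where
  "right_noetherian p \<longleftrightarrow>
     (\<forall>k. k + 2 \<le> degree p \<longrightarrow>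
        (\<exists>r z. poly ((pderiv ^^ k) p) r = 0
             \<and> is_largest_root ((pderiv ^^ (k + 1)) p) z \<and> r \<ge> z))"

text \<open>
  Positivity is part of the definition because \<^const>\<open>ln\<close> is total in HOL.
\<close>

definition log_concave_on :: "real set \<Rightarrow> (real \<Rightarrow> real) \<Rightarrow> bool" where
  "log_concave_on S f \<longleftrightarrow> (\<forall>x\<in>S. f x > 0) \<and> concave_on S (\<lambda>x. ln (f x))"

definition strongly_log_concave :: "real poly \<Rightarrow> bool" where
  "strongly_log_concave q \<longleftrightarrow>
     (\<forall>k. (pderiv ^^ k) q = 0 \<or> log_concave_on {0<..} (poly ((pderiv ^^ k) q)))"

text \<open>The polynomial \<open>y \<mapsto> p (y + c)\<close>.\<close>

definition translate_poly :: "real \<Rightarrow> real poly \<Rightarrow> real poly" where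
  "translate_poly c p = pcompose p [:c, 1:]"

end

theory Submission imports Defs begin

text \<open>
  For a positive twice differentiable function, log-concavity is the inequality
  \<open>f f'' \<le> f'\<^sup>2\<close>, or equivalently that \<open>f' / f\<close> decreases. The proof integrates this inequality:
  it passes from \<open>f'\<close> to \<open>f\<close> on a half-line \<open>(z, \<infinity>)\<close> whose endpoint \<open>z\<close> is a root of \<open>f\<close>
  (\<open>log_concave_above_antiderivative\<close>). Indeed, by Cauchy's mean value theorem
  \<open>(f' x - f' z) / (f x - f z) = f'' c / f' c\<close> for some \<open>c\<close> between \<open>z\<close> and \<open>x\<close>; the right side is
  at least \<open>f'' x / f' x\<close> because \<open>f'\<close> is log-concave, while the left side is at most \<open>f' x / f x\<close>
  because \<open>f z = 0\<close> and \<open>f' z \<ge> 0\<close>.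

  The right-Noetherian condition says that the largest roots of the successive derivatives
  never move to the right. Therefore, if \<open>z\<close> is the largest root of \<open>f\<close>, then the inequality for \<open>f'\<close>,
  which by induction on the degree holds above the largest root of \<open>f'\<close>, holds in particular
  above \<open>z\<close>, and the integration step applies. A negative leading coefficient reduces to a
  positive one, since the hypotheses do not change under \<open>p \<mapsto> - p\<close>.
\<close>

section \<open>The differential inequality for log-concavity\<close>

definition log_concave_above :: "real \<Rightarrow> real poly \<Rightarrow> bool" where
  "log_concave_above z f \<longleftrightarrow>
     (\<forall>x>z. poly f x > 0 \<and> poly f x * poly (pderiv (pderiv f)) x \<le> (poly (pderiv f) x)\<^sup>2)"

lemma log_concave_above_mono:
  "log_concave_above z f \<Longrightarrow> z \<le> w \<Longrightarrow> log_concave_above w f"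
  unfolding log_concave_above_def by auto

text \<open>
  The quotient rule turns the inequality \<open>f f'' \<le> f'\<^sup>2\<close> into the sign of the derivative of
  \<open>f' / f\<close>, which is the second derivative of \<open>ln f\<close>.
\<close>

lemma log_concave_above_DERIV_log_derivative:
  assumes "log_concave_above z f" "z < x"
  obtains d where "DERIV (\<lambda>x. poly (pderiv f) x / poly f x) x :> d" "d \<le> 0"
proof
  have pos: "poly f x > 0"
    and ineq: "poly f x * poly (pderiv (pderiv f)) x \<le> (poly (pderiv f) x)\<^sup>2"
    using assms unfolding log_concave_above_def by auto
  show "DERIV (\<lambda>x. poly (pderiv f) x / poly f x) x :>
      (poly (pderiv (pderiv f)) x * poly f x - poly (pderiv f) x * poly (pderiv f) x)
        / (poly f x * poly f x)"
    using pos by (intro DERIV_divide poly_DERIV) auto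
  show "(poly (pderiv (pderiv f)) x * poly f x - poly (pderiv f) x * poly (pderiv f) x)
        / (poly f x * poly f x) \<le> 0"
    using ineq by (intro divide_nonpos_nonneg) (auto simp: power2_eq_square mult.commute)
qed

lemma log_concave_above_imp_log_concave_on:
  assumes "log_concave_above z f"
  shows "log_concave_on {z<..} (poly f)"
proof -
  have pos: "poly f x > 0" if "x \<in> {z<..}" for x
    using assms that unfolding log_concave_above_def by auto
  have "\<forall>x\<in>{z<..}. \<exists>d. DERIV (\<lambda>x. poly (pderiv f) x / poly f x) x :> d \<and> d \<le> 0"
    by (auto elim: log_concave_above_DERIV_log_derivative[OF assms])
  then obtain d where d: "\<forall>x\<in>{z<..}. DERIV (\<lambda>x. poly (pderiv f) x / poly f x) x :> d x \<and> d x \<le> 0"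
    by (rule bchoice[THEN exE])
  have "concave_on {z<..} (\<lambda>x. ln (poly f x))"
  proof (rule f''_le0_imp_concave[where f'' = d])
    fix x assume x: "x \<in> {z<..}"
    show "DERIV (\<lambda>x. ln (poly f x)) x :> poly (pderiv f) x / poly f x"
      using pos[OF x] by (auto intro!: derivative_eq_intros poly_DERIV)
    show "DERIV (\<lambda>x. poly (pderiv f) x / poly f x) x :> d x" and "d x \<le> 0"
      using d x by blast+
  qed simp
  then show ?thesis
    using pos unfolding log_concave_on_def by auto
qed

lemma log_concave_above_log_derivative_antimono:
  assumes "log_concave_above z f" "z < c" "c \<le> x"
  shows "poly (pderiv f) x / poly f x \<le> poly (pderiv f) c / poly f c"
proof (rule DERIV_nonpos_imp_nonincreasing[OF \<open>c \<le> x\<close>])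
  fix t assume "c \<le> t" "t \<le> x"
  then have "z < t" using assms(2) by simp
  then show "\<exists>y. DERIV (\<lambda>x. poly (pderiv f) x / poly f x) t :> y \<and> y \<le> 0"
    using log_concave_above_DERIV_log_derivative[OF assms(1)] by blast
qed

text \<open>
  The integration step. With \<open>c\<close> the point given by Cauchy's mean value theorem, the chain
  \<open>f'' x / f' x \<le> f'' c / f' c = (f' x - f' z) / f x \<le> f' x / f x\<close>
  gives the inequality for \<open>f\<close> after clearing the positive denominators.
\<close>

lemma log_concave_above_antiderivative:
  assumes lc: "log_concave_above z (pderiv f)" and root: "poly f z = 0"
  shows "log_concave_above z f"
  unfolding log_concave_above_def
proof (intro allI impI conjI)
  have dpos: "poly (pderiv f) y > 0" if "y > z" for y
    using lc that unfolding log_concave_above_def by auto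
  fix x assume x: "z < x"
  obtain u where "z < u" "poly f x - poly f z = (x - z) * poly (pderiv f) u"
    using poly_MVT[OF x] by blast
  then show fpos: "poly f x > 0"
    using root x dpos[of u] by simp
  \<comment> \<open>By continuity; a sign change would be a root of \<open>f'\<close> above \<open>z\<close>.\<close>
  have dz: "poly (pderiv f) z \<ge> 0"
  proof (rule ccontr)
    assume "\<not> poly (pderiv f) z \<ge> 0"
    then obtain y where "z < y" "poly (pderiv f) y = 0"
      using poly_IVT_pos[OF x, of "pderiv f"] dpos[OF x] by auto
    then show False using dpos[of y] by simp
  qed
  obtain c where c: "z < c" "c < x"
    and mvt: "(poly (pderiv f) x - poly (pderiv f) z) * poly (pderiv f) c
      = (poly f x - poly f z) * poly (pderiv (pderiv f)) c"
    using GMVT'[OF x, of "poly (pderiv f)" "poly f" "poly (pderiv f)" "poly (pderiv (pderiv f))"]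
    by (auto simp: poly_DERIV)
  have "poly f x * (poly (pderiv (pderiv f)) x / poly (pderiv f) x)
      \<le> poly f x * (poly (pderiv (pderiv f)) c / poly (pderiv f) c)"
    using log_concave_above_log_derivative_antimono[OF lc c(1), of x] c fpos
    by (intro mult_left_mono) auto
  also have "\<dots> = poly (pderiv f) x - poly (pderiv f) z"
    using mvt root dpos[OF c(1)] by (simp add: field_simps)
  also have "\<dots> \<le> poly (pderiv f) x" using dz by simp
  finally show "poly f x * poly (pderiv (pderiv f)) x \<le> (poly (pderiv f) x)\<^sup>2"
    using dpos[OF x] by (simp add: field_simps power2_eq_square)
qed

section \<open>Right-Noetherian polynomials\<close>

lemma right_noetherian_pderiv:
  assumes "right_noetherian f"
  shows "right_noetherian (pderiv f)"
  unfolding right_noetherian_def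
proof (intro allI impI)
  fix k assume "k + 2 \<le> degree (pderiv f)"
  then have "Suc k + 2 \<le> degree f" by (simp add: degree_pderiv)
  with assms obtain r z where "poly ((pderiv ^^ Suc k) f) r = 0"
    "is_largest_root ((pderiv ^^ (Suc k + 1)) f) z" "r \<ge> z"
    unfolding right_noetherian_def by blast
  then show "\<exists>r z. poly ((pderiv ^^ k) (pderiv f)) r = 0
      \<and> is_largest_root ((pderiv ^^ (k + 1)) (pderiv f)) z \<and> r \<ge> z"
    by (auto simp: funpow_swap1)
qed

lemma lead_coeff_pderiv_pos:
  fixes f :: "real poly"
  assumes "lead_coeff f > 0" "degree f > 0"
  shows "lead_coeff (pderiv f) > 0"
  using assms by (simp add: degree_pderiv coeff_pderiv)

text \<open>
  The derivatives of order at least 1 are covered by the induction hypothesis for \<open>f'\<close>, whose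
  largest root is at most \<open>z\<close>; the integration step then adds order 0. Degree 1 needs a separate
  argument, because then \<open>f'\<close> is a nonzero constant and has no root above which to work.
\<close>

lemma right_noetherian_imp_log_concave_above:
  assumes "right_noetherian f" "is_largest_root f z" "lead_coeff f > 0"
  shows "(pderiv ^^ k) f = 0 \<or> log_concave_above z ((pderiv ^^ k) f)"
  using assms
proof (induction "degree f" arbitrary: f z k rule: less_induct)
  case less
  have root: "poly f z = 0" using less.prems(2) unfolding is_largest_root_def by simp
  have deg: "degree f > 0"
  proof (rule ccontr)
    assume "\<not> degree f > 0"
    then obtain c where "f = [:c:]" using degree_eq_zeroE by auto
    with root less.prems(3) show False by simp
  qed
  have lead: "lead_coeff (pderiv f) > 0"
    using lead_coeff_pderiv_pos less.prems(3) deg by blast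
  have derivs: "(pderiv ^^ j) (pderiv f) = 0 \<or> log_concave_above z ((pderiv ^^ j) (pderiv f))"
    for j
  proof (cases "degree f = 1")
    case True
    then obtain c where c: "pderiv f = [:c:]"
      using degree_eq_zeroE[of "pderiv f"] by (auto simp: degree_pderiv)
    with lead have "c > 0" by simp
    then show ?thesis
      unfolding c by (cases j) (auto simp: log_concave_above_def funpow_swap1 pderiv_pCons)
  next
    case False
    then have "0 + 2 \<le> degree f" using deg by simp
    then obtain r w where r: "poly f r = 0" and w: "is_largest_root (pderiv f) w" and "r \<ge> w"
      using less.prems(1) unfolding right_noetherian_def by fastforce
    then have "w \<le> z"
      using less.prems(2) unfolding is_largest_root_def by fastforce
    moreover have "(pderiv ^^ j) (pderiv f) = 0 \<or> log_concave_above w ((pderiv ^^ j) (pderiv f))"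
      using less.hyps[of "pderiv f" w j] w lead deg right_noetherian_pderiv[OF less.prems(1)]
      by (simp add: degree_pderiv)
    ultimately show ?thesis using log_concave_above_mono by blast
  qed
  show ?case
  proof (cases k)
    case 0
    have "pderiv f \<noteq> 0" using lead by auto
    then have "log_concave_above z (pderiv f)" using derivs[of 0] by simp
    then show ?thesis using log_concave_above_antiderivative root 0 by simp
  next
    case (Suc j)
    then show ?thesis using derivs[of j] by (simp add: funpow_swap1)
  qed
qed

section \<open>Translation and sign change\<close>

lemma pderiv_translate_poly: "pderiv (translate_poly c f) = translate_poly c (pderiv f)"
  unfolding translate_poly_def by (simp add: pderiv_pcompose pderiv_pCons)

lemma higher_pderiv_translate_poly:
  "(pderiv ^^ k) (translate_poly c f) = translate_poly c ((pderiv ^^ k) f)"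
  by (induction k) (simp_all add: pderiv_translate_poly)

lemma log_concave_above_translate_poly:
  assumes "log_concave_above c f"
  shows "log_concave_above 0 (translate_poly c f)"
  using assms unfolding log_concave_above_def pderiv_translate_poly
  by (simp add: translate_poly_def poly_pcompose)

lemma strongly_log_concave_translate_poly:
  assumes "right_noetherian f" "is_largest_root f z" "lead_coeff f > 0"
  shows "strongly_log_concave (translate_poly z f)"
  unfolding strongly_log_concave_def higher_pderiv_translate_poly
proof
  fix k
  consider "(pderiv ^^ k) f = 0" | "log_concave_above z ((pderiv ^^ k) f)"
    using right_noetherian_imp_log_concave_above[OF assms] by blast
  then show "translate_poly z ((pderiv ^^ k) f) = 0
      \<or> log_concave_on {0<..} (poly (translate_poly z ((pderiv ^^ k) f)))"
  proof cases
    case 1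
    then show ?thesis by (simp add: translate_poly_def)
  next
    case 2
    then show ?thesis
      using log_concave_above_translate_poly log_concave_above_imp_log_concave_on by blast
  qed
qed

lemma higher_pderiv_minus: "(pderiv ^^ k) (- f) = - (pderiv ^^ k) (f :: real poly)"
  by (induction k) (simp_all add: pderiv_minus)

lemma is_largest_root_minus: "is_largest_root (- f) z \<longleftrightarrow> is_largest_root f z"
  unfolding is_largest_root_def by simp

lemma right_noetherian_minus: "right_noetherian (- f) \<longleftrightarrow> right_noetherian f"
  unfolding right_noetherian_def higher_pderiv_minus is_largest_root_minus by simp

theorem lemma1p1:
  fixes p :: "real poly" and x\<^sub>0 :: real
  assumes "right_noetherian p"
    and "is_largest_root p x\<^sub>0"
  shows "(lead_coeff p > 0 \<longrightarrow> strongly_log_concave (translate_poly x\<^sub>0 p)) \<and>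
         (lead_coeff p < 0 \<longrightarrow> strongly_log_concave (translate_poly x\<^sub>0 (- p)))"
  using assms strongly_log_concave_translate_poly[of p x\<^sub>0]
    strongly_log_concave_translate_poly[of "- p" x\<^sub>0]
  by (simp add: right_noetherian_minus is_largest_root_minus)

end
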